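(* Let $\alpha$ be a nonzero integer and let $(h_n)$ be the sequence with $h_0=0$, $h_1=1$, $h_2=-\alpha$, $h_3=-\alpha^3$, $h_4=\alpha^6$, and for $m\ge2$: $h_{2m+1}=h_{m+2}h_m^3-h_{m-1}h_{m+1}^3$, for $m\ge 3$: $h_{2m}=h_m\big(h_{m+2}h_{m-1}^2-h_{m-2}h_{m+1}^2\big)/h_2$. (i) If $n\equiv 1,4,6,9\pmod{10}$, then $h_n$ is a square. (ii) If $n\equiv 1,3,4,11,12,14\pmod{15}$, then $h_n$ is a cube.
   Context: The sequence defined is the elliptic divisibility sequence attached to the point $(0,0)$ of order $5$ on $y^2+(1-\alpha)xy-\alpha y=x^3-\alpha x^2$; its fifth term is zero. Convention: an integer $m$ is called a square if $m=\pm\beta^2$ for some nonzero integer $\beta$, and a cube if $m=\beta^3$ for some nonzero integer $\beta$. *)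

theory Defs
  imports Complex_Main
begin

text \<open>Squares are taken up to sign, and both notions exclude \<open>0\<close>.\<close>

definition is_square_upto_sign :: "int \<Rightarrow> bool" where
  "is_square_upto_sign m \<longleftrightarrow> (\<exists>\<beta>::int. \<beta> \<noteq> 0 \<and> (m = \<beta>\<^sup>2 \<or> m = - (\<beta>\<^sup>2)))"

definition is_nonzero_cube :: "int \<Rightarrow> bool" where
  "is_nonzero_cube m \<longleftrightarrow> (\<exists>\<beta>::int. \<beta> \<noteq> 0 \<and> m = \<beta> ^ 3)"

text \<open>
  The even-index recurrence divides by \<open>h 2\<close>, so the sequence is taken over the rationals,
  where this is genuine division; that the terms are integers is not assumed.
  Subtraction on \<open>nat\<close> never truncates under the stated lower bounds on \<open>m\<close>.
\<close>

definition eds_order5 :: "int \<Rightarrow> (nat \<Rightarrow> rat) \<Rightarrow> bool" where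
  "eds_order5 \<alpha> h \<longleftrightarrow>
     h 0 = 0 \<and> h 1 = 1 \<and> h 2 = - of_int \<alpha> \<and> h 3 = - (of_int \<alpha> ^ 3) \<and> h 4 = of_int \<alpha> ^ 6 \<and>
     (\<forall>m\<ge>2. h (2 * m + 1) = h (m + 2) * h m ^ 3 - h (m - 1) * h (m + 1) ^ 3) \<and>
     (\<forall>m\<ge>3. h (2 * m) = h m * (h (m + 2) * (h (m - 1))\<^sup>2 - h (m - 2) * (h (m + 1))\<^sup>2) / h 2)"

end

theory Submission
  imports Defs
begin

text \<open>
  Because the point has order \<open>5\<close>, every term is \<open>0\<close> or plus or minus a power of \<open>\<alpha>\<close>:
  for \<open>n = 5 k + r\<close> with \<open>r = 1, 2, 3, 4\<close> one has
  \<open>h n = (-1)^k s \<alpha>^(10 k\<^sup>2 + 4 k r + e)\<close> with \<open>s = 1, -1, -1, 1\<close> and \<open>e = 0, 1, 3, 6\<close>, and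
  \<open>h n = 0\<close> for \<open>r = 0\<close>. This closed form satisfies the recurrences, which determine the sequence,
  and the residue conditions on \<open>n\<close> make the exponent divisible by \<open>2\<close> or by \<open>3\<close>.
\<close>

text \<open>The exponent is the floor of \<open>2 * n^2 / 5\<close>; the list holds the floors of
  \<open>2 * r^2 / 5\<close> for \<open>r < 5\<close>. The type is left general so that the rational
  terms can be traced back to integers.\<close>

definition eds5_form :: "'a::comm_ring_1 \<Rightarrow> nat \<Rightarrow> 'a" where
  "eds5_form a n =
     (-1) ^ (n div 5) * (if n mod 5 = 0 then 0 else if n mod 5 \<in> {1, 4} then 1 else -1) *
     a ^ (10 * (n div 5)\<^sup>2 + 4 * (n div 5) * (n mod 5) + [0, 0, 1, 3, 6] ! (n mod 5))"

text \<open>The index enters through an equation so that the formulas apply to compound indices such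
  as \<open>2 * n + 5\<close>.\<close>

lemma eds5_form_residues:
  "n = 5 * k \<Longrightarrow> eds5_form a n = 0"
  "n = 5 * k + 1 \<Longrightarrow> eds5_form a n = (-1) ^ k * a ^ (10 * k\<^sup>2 + 4 * k)"
  "n = 5 * k + 2 \<Longrightarrow> eds5_form a n = - ((-1) ^ k * a ^ (10 * k\<^sup>2 + 8 * k + 1))"
  "n = 5 * k + 3 \<Longrightarrow> eds5_form a n = - ((-1) ^ k * a ^ (10 * k\<^sup>2 + 12 * k + 3))"
  "n = 5 * k + 4 \<Longrightarrow> eds5_form a n = (-1) ^ k * a ^ (10 * k\<^sup>2 + 16 * k + 6)"
proof -
  have "(5 * k + 1) mod 5 = 1" "(5 * k + 2) mod 5 = 2" "(5 * k + 3) mod 5 = 3"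
    "(5 * k + 4) mod 5 = 4" "(5 * k + 1) div 5 = k" "(5 * k + 2) div 5 = k"
    "(5 * k + 3) div 5 = k" "(5 * k + 4) div 5 = k"
    by presburger+
  note residues = this
  show
    "n = 5 * k \<Longrightarrow> eds5_form a n = 0"
    "n = 5 * k + 1 \<Longrightarrow> eds5_form a n = (-1) ^ k * a ^ (10 * k\<^sup>2 + 4 * k)"
    "n = 5 * k + 2 \<Longrightarrow> eds5_form a n = - ((-1) ^ k * a ^ (10 * k\<^sup>2 + 8 * k + 1))"
    "n = 5 * k + 3 \<Longrightarrow> eds5_form a n = - ((-1) ^ k * a ^ (10 * k\<^sup>2 + 12 * k + 3))"
    "n = 5 * k + 4 \<Longrightarrow> eds5_form a n = (-1) ^ k * a ^ (10 * k\<^sup>2 + 16 * k + 6)"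
    by (simp_all only: eds5_form_def residues) (simp_all add: algebra_simps)
qed

lemma mod5_cases:
  obtains j where "n = 5 * j" | j where "n = 5 * j + 1" | j where "n = 5 * j + 2"
    | j where "n = 5 * j + 3" | j where "n = 5 * j + (4::nat)"
proof -
  have "n = 5 * (n div 5) \<or> n = 5 * (n div 5) + 1 \<or> n = 5 * (n div 5) + 2
    \<or> n = 5 * (n div 5) + 3 \<or> n = 5 * (n div 5) + 4"
    by presburger
  then show ?thesis
    using that by blast
qed

text \<open>Merges products of powers of \<open>a\<close> into one power with expanded exponent and
  turns signs into parity tests, so that monomials can be compared.\<close>

lemmas eds5_arith = power2_eq_square power3_eq_cube algebra_simps power_add[symmetric]
  power_mult_distrib minus_one_power_iff

text \<open>The recurrence at \<open>m = n + 2\<close>, free of subtraction on indices. If 5 divides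
  \<open>n\<close>, the left side is 0 and the two products are equal monomials. Otherwise 5 divides
  exactly one of \<open>n + 1\<close>, ..., \<open>n + 4\<close>, so one product vanishes and the
  other is the left side.\<close>

lemma eds5_form_odd:
  "eds5_form a (2 * n + 5) =
     eds5_form a (n + 4) * eds5_form a (n + 2) ^ 3 - eds5_form a (n + 1) * eds5_form a (n + 3) ^ 3"
proof (cases n rule: mod5_cases)
  case (1 j)
  \<comment> \<open>The second argument is the quotient of the index by 5; among the shifts of
    \<open>n\<close> it rises from \<open>j\<close> to \<open>j + 1\<close> at the multiple of
    5.\<close>
  note f = eds5_form_residues(1)[of "2 * n + 5" "2 * j + 1" a] eds5_form_residues(2)[of "n + 1" j a]
    eds5_form_residues(3)[of "n + 2" j a] eds5_form_residues(4)[of "n + 3" j a]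
    eds5_form_residues(5)[of "n + 4" j a]
  show ?thesis using f 1 by (simp add: eds5_arith flip: power_Suc)
next
  case (2 j)
  note f = eds5_form_residues(3)[of "2 * n + 5" "2 * j + 1" a] eds5_form_residues(3)[of "n + 1" j a]
    eds5_form_residues(4)[of "n + 2" j a] eds5_form_residues(5)[of "n + 3" j a]
    eds5_form_residues(1)[of "n + 4" "j + 1" a]
  show ?thesis using f 2 by (simp add: eds5_arith flip: power_Suc)
next
  case (3 j)
  note f = eds5_form_residues(5)[of "2 * n + 5" "2 * j + 1" a] eds5_form_residues(4)[of "n + 1" j a]
    eds5_form_residues(5)[of "n + 2" j a] eds5_form_residues(1)[of "n + 3" "j + 1" a]
    eds5_form_residues(2)[of "n + 4" "j + 1" a]
  show ?thesis using f 3 by (simp add: eds5_arith flip: power_Suc)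
next
  case (4 j)
  note f = eds5_form_residues(2)[of "2 * n + 5" "2 * j + 2" a] eds5_form_residues(5)[of "n + 1" j a]
    eds5_form_residues(1)[of "n + 2" "j + 1" a] eds5_form_residues(2)[of "n + 3" "j + 1" a]
    eds5_form_residues(3)[of "n + 4" "j + 1" a]
  show ?thesis using f 4 by (simp add: eds5_arith flip: power_Suc)
next
  case (5 j)
  note f = eds5_form_residues(4)[of "2 * n + 5" "2 * j + 2" a] eds5_form_residues(1)[of "n + 1" "j + 1" a]
    eds5_form_residues(2)[of "n + 2" "j + 1" a] eds5_form_residues(3)[of "n + 3" "j + 1" a]
    eds5_form_residues(4)[of "n + 4" "j + 1" a]
  show ?thesis using f 5 by (simp add: eds5_arith flip: power_Suc)
qed

text \<open>Multiplying by \<open>h 2 = - a\<close> removes the division. Exactly one of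
  \<open>n\<close>, ..., \<open>n + 4\<close> is a multiple of 5: if it is \<open>n + 2\<close>,
  both sides are 0; otherwise one term of the bracket vanishes and a comparison of monomials
  remains.\<close>

lemma eds5_form_even:
  "- a * eds5_form a (2 * n + 4) =
     eds5_form a (n + 2) *
       (eds5_form a (n + 4) * (eds5_form a (n + 1))\<^sup>2 - eds5_form a n * (eds5_form a (n + 3))\<^sup>2)"
proof (cases n rule: mod5_cases)
  case (1 j)
  note f = eds5_form_residues(5)[of "2 * n + 4" "2 * j" a] eds5_form_residues(1)[of n j a]
    eds5_form_residues(2)[of "n + 1" j a]
    eds5_form_residues(3)[of "n + 2" j a] eds5_form_residues(4)[of "n + 3" j a]
    eds5_form_residues(5)[of "n + 4" j a]
  show ?thesis using f 1 by (simp add: eds5_arith flip: power_Suc)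
next
  case (2 j)
  note f = eds5_form_residues(2)[of "2 * n + 4" "2 * j + 1" a] eds5_form_residues(2)[of n j a]
    eds5_form_residues(3)[of "n + 1" j a]
    eds5_form_residues(4)[of "n + 2" j a] eds5_form_residues(5)[of "n + 3" j a]
    eds5_form_residues(1)[of "n + 4" "j + 1" a]
  show ?thesis using f 2 by (simp add: eds5_arith flip: power_Suc)
next
  case (3 j)
  note f = eds5_form_residues(4)[of "2 * n + 4" "2 * j + 1" a] eds5_form_residues(3)[of n j a]
    eds5_form_residues(4)[of "n + 1" j a]
    eds5_form_residues(5)[of "n + 2" j a] eds5_form_residues(1)[of "n + 3" "j + 1" a]
    eds5_form_residues(2)[of "n + 4" "j + 1" a]
  show ?thesis using f 3 by (simp add: eds5_arith flip: power_Suc)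
next
  case (4 j)
  note f = eds5_form_residues(1)[of "2 * n + 4" "2 * j + 2" a]
    eds5_form_residues(1)[of "n + 2" "j + 1" a]
  show ?thesis using f 4 by simp
next
  case (5 j)
  note f = eds5_form_residues(3)[of "2 * n + 4" "2 * j + 2" a] eds5_form_residues(5)[of n j a]
    eds5_form_residues(1)[of "n + 1" "j + 1" a]
    eds5_form_residues(2)[of "n + 2" "j + 1" a] eds5_form_residues(3)[of "n + 3" "j + 1" a]
    eds5_form_residues(4)[of "n + 4" "j + 1" a]
  show ?thesis using f 5 by (simp add: eds5_arith flip: power_Suc)
qed

lemma eds_order5_closed_form:
  assumes "\<alpha> \<noteq> 0" and "eds_order5 \<alpha> h"
  shows "h n = eds5_form (of_int \<alpha>) n"
proof (induction n rule: less_induct)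
  case (less n)
  let ?c = "eds5_form (of_int \<alpha> :: rat)"
  have init: "h 0 = 0" "h 1 = 1" "h 2 = - of_int \<alpha>" "h 3 = - (of_int \<alpha> ^ 3)" "h 4 = of_int \<alpha> ^ 6"
    and odd: "\<And>m. m \<ge> 2 \<Longrightarrow> h (2 * m + 1) = h (m + 2) * h m ^ 3 - h (m - 1) * h (m + 1) ^ 3"
    and even: "\<And>m. m \<ge> 3 \<Longrightarrow>
      h (2 * m) = h m * (h (m + 2) * (h (m - 1))\<^sup>2 - h (m - 2) * (h (m + 1))\<^sup>2) / h 2"
    using assms(2) unfolding eds_order5_def by auto
  \<comment> \<open>The recurrences reach up to index \<open>m + 4\<close>, which is below
    \<open>2 * m + 5\<close> always but below \<open>2 * m + 4\<close> only for
    \<open>m \<ge> 1\<close>; hence 4 is an initial case.\<close>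
  consider "n = 0" | "n = 1" | "n = 2" | "n = 3" | "n = 4" | m where "n = 2 * m + 5"
    | m where "n = 2 * m + 4" "m \<ge> 1"
  proof -
    have "n = 0 \<or> n = 1 \<or> n = 2 \<or> n = 3 \<or> n = 4 \<or> n = 2 * ((n - 5) div 2) + 5
      \<or> n = 2 * ((n - 4) div 2) + 4 \<and> (n - 4) div 2 \<ge> 1"
      by presburger
    then show ?thesis
      using that by blast
  qed
  then show ?case
  proof cases
    case (6 m)
    have "h n = h (m + 4) * h (m + 2) ^ 3 - h (m + 1) * h (m + 3) ^ 3"
      using odd[of "m + 2"] 6 by (simp add: eval_nat_numeral)
    also have "\<dots> = ?c (m + 4) * ?c (m + 2) ^ 3 - ?c (m + 1) * ?c (m + 3) ^ 3"
      using 6 by (simp add: less)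
    finally show ?thesis
      by (simp only: 6 eds5_form_odd)
  next
    case (7 m)
    have "h n = h (m + 2) * (h (m + 4) * (h (m + 1))\<^sup>2 - h m * (h (m + 3))\<^sup>2) / (- of_int \<alpha>)"
      using even[of "m + 2"] 7 init(3) by (simp add: eval_nat_numeral)
    also have "\<dots> = ?c (m + 2) * (?c (m + 4) * (?c (m + 1))\<^sup>2 - ?c m * (?c (m + 3))\<^sup>2) / (- of_int \<alpha>)"
      using 7 by (simp add: less)
    also have "\<dots> = ?c n"
      \<comment> \<open>The numerator is \<open>- \<alpha>\<close> times the closed form at
        \<open>n\<close>, and \<open>\<alpha> \<noteq> 0\<close> allows cancellation.\<close>
      using assms(1) by (simp only: 7 eds5_form_even[symmetric]) simp
    finally show ?thesis .
  qed (use init in \<open>simp_all add: eds5_form_def\<close>)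
qed

text \<open>Yields integrality of the terms of \<open>h\<close>.\<close>

lemma of_int_eds5_form: "of_int (eds5_form a n) = eds5_form (of_int a) n"
  by (simp add: eds5_form_def)

lemma is_square_upto_sign_power:
  assumes "a \<noteq> 0" "even e"
  shows "is_square_upto_sign ((-1) ^ k * a ^ e)"
proof -
  obtain f where "e = f * 2" using assms(2) by (auto elim: evenE)
  then show ?thesis
    using assms(1) unfolding is_square_upto_sign_def
    \<comment> \<open>The sign selects between the two alternatives of the definition.\<close>
    by (intro exI[of _ "a ^ f"]) (auto simp: minus_one_power_iff simp flip: power_mult)
qed

lemma is_nonzero_cube_power:
  assumes "a \<noteq> 0" "3 dvd e"
  shows "is_nonzero_cube ((-1) ^ k * a ^ e)"
proof -
  obtain f where "e = f * 3" using assms(2) by (metis dvdE mult.commute)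
  then show ?thesis
    using assms(1) unfolding is_nonzero_cube_def
    \<comment> \<open>The sign \<open>(-1) ^ k\<close> is its own cube, so it moves into the
      root.\<close>
    by (intro exI[of _ "(-1) ^ k * a ^ f"]) (auto simp: minus_one_power_iff simp flip: power_mult)
qed

lemma is_nonzero_cube_minus: "is_nonzero_cube m \<Longrightarrow> is_nonzero_cube (- m)"
  unfolding is_nonzero_cube_def by (metis neg_equal_0_iff_equal odd_numeral power_minus_odd)

text \<open>The residues mod 10 amount to \<open>n mod 5\<close> being 1 or 4, where the exponents
  \<open>10 * k^2 + 4 * k\<close> and \<open>10 * k^2 + 16 * k + 6\<close> are even for every
  \<open>k\<close>.\<close>

lemma eds5_form_square:
  assumes "a \<noteq> 0" "n mod 10 \<in> {1, 4, 6, 9}"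
  shows "is_square_upto_sign (eds5_form a n)"
proof -
  from assms(2) have "n = 5 * (n div 5) + 1 \<or> n = 5 * (n div 5) + 4"
    by auto presburger+
  then show ?thesis
  proof
    assume "n = 5 * (n div 5) + 1"
    from eds5_form_residues(2)[OF this, of a] show ?thesis
      using is_square_upto_sign_power[OF assms(1)] by simp
  next
    assume "n = 5 * (n div 5) + 4"
    from eds5_form_residues(5)[OF this, of a] show ?thesis
      using is_square_upto_sign_power[OF assms(1)] by simp
  qed
qed

text \<open>For \<open>n = 5 * k + r\<close> the exponent is, mod 3, \<open>k * (k + 1)\<close> if
  \<open>r\<close> is 1 or 4, \<open>(k + 1)^2\<close> if \<open>r = 2\<close>, and
  \<open>k^2\<close> if \<open>r = 3\<close>. It vanishes for \<open>k\<close> congruent to 0 or 2,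
  to 2, and to 0 respectively, which gives exactly the six residues mod 15.\<close>

lemma eds5_form_cube:
  assumes "a \<noteq> 0" "n mod 15 \<in> {1, 3, 4, 11, 12, 14}"
  shows "is_nonzero_cube (eds5_form a n)"
proof -
  \<comment> \<open>The negated version serves \<open>r = 2\<close> and \<open>r = 3\<close>, whose
    closed forms carry an extra minus sign.\<close>
  note cube = is_nonzero_cube_power[OF assms(1)]
    is_nonzero_cube_minus[OF is_nonzero_cube_power[OF assms(1)]]
  define i where "i = n div 15"
  have "n = 15 * i + n mod 15"
    by (simp add: i_def)
  with assms(2) consider "n = 5 * (3 * i) + 1" | "n = 5 * (3 * i) + 3" | "n = 5 * (3 * i) + 4"
    | "n = 5 * (3 * i + 2) + 1" | "n = 5 * (3 * i + 2) + 2" | "n = 5 * (3 * i + 2) + 4"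
    by auto
  then show ?thesis
  proof cases
    case 1
    show ?thesis unfolding eds5_form_residues(2)[OF 1] by (rule cube)
      (simp add: power2_eq_square; presburger)
  next
    case 2
    show ?thesis unfolding eds5_form_residues(4)[OF 2] by (rule cube)
      (simp add: power2_eq_square; presburger)
  next
    case 3
    show ?thesis unfolding eds5_form_residues(5)[OF 3] by (rule cube)
      (simp add: power2_eq_square; presburger)
  next
    case 4
    show ?thesis unfolding eds5_form_residues(2)[OF 4] by (rule cube)
      (simp add: power2_eq_square algebra_simps; presburger)
  next
    case 5
    show ?thesis unfolding eds5_form_residues(3)[OF 5] by (rule cube)
      (simp add: power2_eq_square algebra_simps; presburger)
  next
    case 6
    show ?thesis unfolding eds5_form_residues(5)[OF 6] by (rule cube)
      (simp add: power2_eq_square algebra_simps; presburger)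
  qed
qed

theorem theorem5p3:
  fixes \<alpha> :: int and h :: "nat \<Rightarrow> rat"
  assumes "\<alpha> \<noteq> 0"
    and "eds_order5 \<alpha> h"
  shows "(\<forall>n. n mod 10 \<in> {1, 4, 6, 9} \<longrightarrow>
            (\<exists>m. h n = of_int m \<and> is_square_upto_sign m)) \<and>
         (\<forall>n. n mod 15 \<in> {1, 3, 4, 11, 12, 14} \<longrightarrow>
            (\<exists>m. h n = of_int m \<and> is_nonzero_cube m))"
proof -
  have "h n = of_int (eds5_form \<alpha> n)" for n
    using eds_order5_closed_form[OF assms] by (simp add: of_int_eds5_form)
  then show ?thesis
    using eds5_form_square[OF assms(1)] eds5_form_cube[OF assms(1)] by blast
qed

end
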